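(* Let $\mathcal{S}$ be a finite set of scenarios with $|\mathcal{S}|\ge 2$. Let the decision set $\mathcal{D}$ be an interval $[x_a,x_b]$ of the real line, where $x_a=-\infty$ and/or $x_b=\infty$ is allowed, and for each $i\in\mathcal{S}$ let $f_i:\mathcal{D}\to\mathbb{R}$ be a strictly convex cost function. For each nonempty $\mathcal{S}'\subseteq\mathcal{S}$ let $f_{\mathcal{S}'}(x)=\max_{i\in\mathcal{S}'}f_i(x)$ and let $x^*_{\mathcal{S}'}$ be the (unique) minimiser of $f_{\mathcal{S}'}$ over $\mathcal{D}$, these minimisers being assumed to exist; write $f_{kl}=f_{\{k,l\}}$ and $x^*_{kl}=x^*_{\{k,l\}}$. Then there always exist two (distinct) scenarios $k,l\in\mathcal{S}$ such that $$f_i(x^*_{kl})\le f_{kl}(x^*_{kl})\quad\text{for all } i\in\mathcal{S}.$$ In particular, for such $k,l$, $x^*_{\mathcal{S}}=x^*_{kl}$, and indeed $x^*_{\mathcal{S}'}=x^*_{kl}$ for every subset $\mathcal{S}'$ of $\mathcal{S}$ which contains both $k$ and $l$.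
   Context: A decision problem consists of a finite set $\mathcal{S}$ of scenarios, a set $\mathcal{D}$ of possible decisions, and for each scenario $i\in\mathcal{S}$ a real-valued cost function $f_i$ on $\mathcal{D}$. The minimax solution $x^*_{\mathcal{S}'}$ associated with a nonempty subset $\mathcal{S}'\subseteq\mathcal{S}$ is the value of $x\in\mathcal{D}$ which minimises $f_{\mathcal{S}'}(x)=\max_{i\in\mathcal{S}'}f_i(x)$; strict convexity makes it unique. When $x_a=-\infty$ or $x_b=\infty$, $\mathcal{D}$ denotes the set of real numbers $x$ with $x_a\le x\le x_b$. *)

theory Defs
  imports "HOL-Analysis.Analysis"
begin

definition real_interval :: "ereal \<Rightarrow> ereal \<Rightarrow> real set" where
  "real_interval a b = {x. a \<le> ereal x \<and> ereal x \<le> b}"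

(* The strict counterpart of the library's convex_on. *)
definition strictly_convex_on :: "real set \<Rightarrow> (real \<Rightarrow> real) \<Rightarrow> bool" where
  "strictly_convex_on D f \<longleftrightarrow> convex D \<and>
     (\<forall>x\<in>D. \<forall>y\<in>D. x \<noteq> y \<longrightarrow>
        (\<forall>u>0. \<forall>v>0. u + v = 1 \<longrightarrow> f (u * x + v * y) < u * f x + v * f y))"

(* Only meaningful for a finite nonempty set T. *)
definition worst_cost :: "('s \<Rightarrow> real \<Rightarrow> real) \<Rightarrow> 's set \<Rightarrow> real \<Rightarrow> real" where
  "worst_cost f T x = (MAX i\<in>T. f i x)"

(* Only meaningful if a minimiser exists; it is then unique under strict convexity
   (minimax_solution_unique below). *)
definition minimax_solution :: "('s \<Rightarrow> real \<Rightarrow> real) \<Rightarrow> real set \<Rightarrow> 's set \<Rightarrow> real" where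
  "minimax_solution f D T = (THE x. is_arg_min (worst_cost f T) (\<lambda>x. x \<in> D) x)"

lemma minimax_solution_unique:
  assumes fin: "finite T" and ne: "T \<noteq> {}"
    and cvx: "\<And>i. i \<in> T \<Longrightarrow> strictly_convex_on D (f i)"
    and x: "is_arg_min (worst_cost f T) (\<lambda>x. x \<in> D) x"
    and y: "is_arg_min (worst_cost f T) (\<lambda>x. x \<in> D) y"
  shows "x = y"
proof (rule ccontr)
  assume "x \<noteq> y"
  define z where "z = (1/2) * x + (1/2) * y"
  define m where "m = worst_cost f T x"
  have xD: "x \<in> D" and yD: "y \<in> D" and my: "worst_cost f T y = m"
    using x y by (auto simp: is_arg_min_linorder m_def intro: antisym)
  obtain i0 where "i0 \<in> T" using ne by blast
  then have "convex D" using cvx by (auto simp: strictly_convex_on_def)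
  then have zD: "z \<in> D"
    using convexD[of D x y "1/2" "1/2"] xD yD by (simp add: z_def)
  have "f i z < m" if "i \<in> T" for i
  proof -
    have "f i z < (1/2) * f i x + (1/2) * f i y"
      unfolding z_def
      using cvx[OF that, unfolded strictly_convex_on_def, THEN conjunct2, rule_format,
          OF xD yD \<open>x \<noteq> y\<close>, of "1/2" "1/2"]
      by simp
    moreover have "f i w \<le> worst_cost f T w" for w
      using that fin by (simp add: worst_cost_def)
    then have "f i x \<le> m" "f i y \<le> m"
      using my m_def by metis+
    ultimately show ?thesis by simp
  qed
  then have "worst_cost f T z < m"
    using fin ne by (simp add: worst_cost_def)
  moreover have "m \<le> worst_cost f T z"
    using x zD by (simp add: is_arg_min_linorder m_def)
  ultimately show False by simp
qed

lemma is_arg_min_minimax_solution: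
  assumes "finite T" "T \<noteq> {}"
    and "\<And>i. i \<in> T \<Longrightarrow> strictly_convex_on D (f i)"
    and "\<exists>x. is_arg_min (worst_cost f T) (\<lambda>x. x \<in> D) x"
  shows "is_arg_min (worst_cost f T) (\<lambda>x. x \<in> D) (minimax_solution f D T)"
proof -
  have "\<exists>!x. is_arg_min (worst_cost f T) (\<lambda>x. x \<in> D) x"
    using assms(4) minimax_solution_unique[of T D f, OF assms(1-3)] by blast
  then show ?thesis
    unfolding minimax_solution_def by (rule theI')
qed

end

theory Submission
  imports Defs
begin

text \<open>
  Among all pairs of distinct scenarios, choose \<open>k\<close>, \<open>l\<close> whose optimal value \<open>v\<close>, the minimum of
  the worst cost of the pair, is largest. For each scenario \<open>j\<close> consider the sublevel set
  \<open>L j = {x \<in> D. f j x \<le> v}\<close>, a convex subset of the line. Maximality of \<open>v\<close> says that any two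
  of these sets meet, for the minimiser of a pair has cost at most \<open>v\<close> in both of its scenarios.
  By Helly's theorem on the line the sets \<open>L k\<close>, \<open>L l\<close>, \<open>L i\<close> have a common point, for each
  further scenario \<open>i\<close>. But \<open>L k \<inter> L l\<close> consists of the minimiser of the pair alone, as
  strict convexity makes that minimiser unique; hence it lies in \<open>L i\<close>, as claimed. Since the
  argument speaks of convex sets only, it also covers cost functions that jump at an end point of
  the interval.

  Given such a pair and a set \<open>T\<close> of scenarios that contains it, the worst cost over \<open>T\<close>
  is nowhere below that of the pair and agrees with it at the minimiser of the pair, which is
  therefore also the minimiser for \<open>T\<close>.
\<close>

text \<open>
  Helly's theorem on the line for three sets. Of three points, one from each pairwise
  intersection, the middle one lies in the third set too, because that set contains both
  outer points.
\<close>

lemma three_pairwise_meeting_convex_real_sets_meet: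
  fixes A B C :: "real set"
  assumes "convex A" "convex B" "convex C"
    and "A \<inter> B \<noteq> {}" "A \<inter> C \<noteq> {}" "B \<inter> C \<noteq> {}"
  shows "A \<inter> B \<inter> C \<noteq> {}"
proof -
  have between: "y \<in> X" if "convex X" "x \<in> X" "z \<in> X" "x \<le> y" "y \<le> z" for X and x y z :: real
    using that is_interval_convex_1[of X] mem_is_interval_1_I by blast
  obtain p q r where "p \<in> A" "p \<in> B" "q \<in> A" "q \<in> C" "r \<in> B" "r \<in> C"
    using assms(4-6) by blast
  then have "p \<in> C \<or> q \<in> B \<or> r \<in> A"
    using between[OF assms(1)] between[OF assms(2)] between[OF assms(3)] linear by metis
  then show ?thesis
    using \<open>p \<in> A\<close> \<open>p \<in> B\<close> \<open>q \<in> A\<close> \<open>q \<in> C\<close> \<open>r \<in> B\<close> \<open>r \<in> C\<close> by blast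
qed

lemma strictly_convex_on_imp_convex_on:
  assumes "strictly_convex_on D f"
  shows "convex_on D f"
proof (rule convex_onI)
  show "convex D"
    using assms by (simp add: strictly_convex_on_def)
  fix t x y :: real
  assume "0 < t" "t < 1" "x \<in> D" "y \<in> D"
  show "f ((1 - t) *\<^sub>R x + t *\<^sub>R y) \<le> (1 - t) * f x + t * f y"
  proof (cases "x = y")
    case True
    then show ?thesis by (simp add: algebra_simps)
  next
    case False
    then have "f ((1 - t) * x + t * y) < (1 - t) * f x + t * f y"
      using assms \<open>0 < t\<close> \<open>t < 1\<close> \<open>x \<in> D\<close> \<open>y \<in> D\<close>
      by (simp add: strictly_convex_on_def)
    then show ?thesis by simp
  qed
qed

lemma convex_sublevel_set:
  fixes f :: "real \<Rightarrow> real"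
  assumes "convex_on D f"
  shows "convex {x \<in> D. f x \<le> v}"
proof (rule convexI)
  fix x y a b :: real
  assume x: "x \<in> {x \<in> D. f x \<le> v}" and y: "y \<in> {x \<in> D. f x \<le> v}"
    and ab: "0 \<le> a" "0 \<le> b" "a + b = 1"
  have "a *\<^sub>R x + b *\<^sub>R y \<in> D"
    using convexD[OF convex_on_imp_convex[OF assms], of x y a b] x y ab by simp
  moreover have "f (a *\<^sub>R x + b *\<^sub>R y) \<le> a * f x + b * f y"
    using assms x y ab by (simp add: convex_on_def)
  moreover have "a * f x + b * f y \<le> v"
    using convex_bound_le[of "f x" v "f y" a b] x y ab by simp
  ultimately show "a *\<^sub>R x + b *\<^sub>R y \<in> {x \<in> D. f x \<le> v}" by simp
qed

lemma worst_cost_le_iff: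
  assumes "finite T" "T \<noteq> {}"
  shows "worst_cost f T x \<le> c \<longleftrightarrow> (\<forall>i\<in>T. f i x \<le> c)"
  using assms by (simp add: worst_cost_def)

lemma worst_cost_mono:
  assumes "finite T" "U \<noteq> {}" "U \<subseteq> T"
  shows "worst_cost f U x \<le> worst_cost f T x"
  unfolding worst_cost_def using assms by (intro Max_mono) auto

lemma minimax_solution_eqI:
  assumes "finite T" "T \<noteq> {}" "\<And>i. i \<in> T \<Longrightarrow> strictly_convex_on D (f i)"
    and "is_arg_min (worst_cost f T) (\<lambda>x. x \<in> D) x"
  shows "minimax_solution f D T = x"
  using is_arg_min_minimax_solution[of T D f] minimax_solution_unique[of T D f] assms by blast

text \<open>
  Enlarging the set of scenarios can only raise the worst cost, so the minimiser is kept as soon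
  as the worst cost at that one point is not raised.
\<close>

lemma minimax_solution_superset:
  assumes "finite T" "U \<noteq> {}" "U \<subseteq> T"
    and cvx: "\<And>i. i \<in> T \<Longrightarrow> strictly_convex_on D (f i)"
    and ex: "\<exists>x. is_arg_min (worst_cost f U) (\<lambda>x. x \<in> D) x"
    and dominated: "\<And>i. i \<in> T \<Longrightarrow>
      f i (minimax_solution f D U) \<le> worst_cost f U (minimax_solution f D U)"
  shows "minimax_solution f D T = minimax_solution f D U"
proof (rule minimax_solution_eqI)
  let ?x = "minimax_solution f D U"
  have min_U: "is_arg_min (worst_cost f U) (\<lambda>x. x \<in> D) ?x"
    using is_arg_min_minimax_solution[OF finite_subset[OF assms(3,1)] assms(2) _ ex] cvx assms(3)
    by blast
  have "T \<noteq> {}" using assms(2,3) by blast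
  then have "worst_cost f T ?x \<le> worst_cost f U ?x"
    using dominated \<open>finite T\<close> by (simp add: worst_cost_le_iff)
  then show "is_arg_min (worst_cost f T) (\<lambda>x. x \<in> D) ?x"
    using min_U worst_cost_mono[OF assms(1-3), of f]
    unfolding is_arg_min_linorder by (meson order_trans)
  show "T \<noteq> {}" by fact
qed (use assms in auto)

text \<open>
  The step that carries the theorem: a pair of scenarios with the largest optimal value dominates
  every third scenario at its own minimiser. The points \<open>y\<close> and \<open>z\<close> express maximality against
  the two pairs in which the third scenario replaces a member of the pair.
\<close>

lemma third_scenario_dominated:
  assumes cvx: "\<And>j. j \<in> {i, k, l} \<Longrightarrow> strictly_convex_on D (f j)"
    and x: "is_arg_min (worst_cost f {k, l}) (\<lambda>x. x \<in> D) x"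
    and y: "y \<in> D" "worst_cost f {k, i} y \<le> worst_cost f {k, l} x"
    and z: "z \<in> D" "worst_cost f {l, i} z \<le> worst_cost f {k, l} x"
  shows "f i x \<le> worst_cost f {k, l} x"
proof -
  define v where "v = worst_cost f {k, l} x"
  define L where "L j = {w \<in> D. f j w \<le> v}" for j
  have L_convex: "convex (L j)" if "j \<in> {i, k, l}" for j
    unfolding L_def using cvx[OF that]
    by (intro convex_sublevel_set strictly_convex_on_imp_convex_on)
  have "x \<in> L k \<inter> L l"
    using x worst_cost_le_iff[of "{k, l}" f x v]
    by (simp add: L_def v_def is_arg_min_linorder)
  moreover have "y \<in> L k \<inter> L i"
    using y worst_cost_le_iff[of "{k, i}" f y v] by (simp add: L_def v_def)
  moreover have "z \<in> L l \<inter> L i"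
    using z worst_cost_le_iff[of "{l, i}" f z v] by (simp add: L_def v_def)
  ultimately have "L k \<inter> L l \<inter> L i \<noteq> {}"
    by (intro three_pairwise_meeting_convex_real_sets_meet L_convex) auto
  then obtain w where w: "w \<in> L k" "w \<in> L l" "w \<in> L i" by blast
  then have "worst_cost f {k, l} w \<le> v"
    by (simp add: worst_cost_le_iff L_def)
  then have "is_arg_min (worst_cost f {k, l}) (\<lambda>x. x \<in> D) w"
    using x w(1) by (auto simp: is_arg_min_linorder v_def L_def intro: order_trans)
  then have "w = x"
    using minimax_solution_unique[of "{k, l}" D f] x cvx by blast
  then show ?thesis
    using w(3) by (simp add: L_def v_def)
qed

theorem proposition1:
  fixes S :: "'s set" and x\<^sub>a x\<^sub>b :: ereal and D :: "real set"
    and f :: "'s \<Rightarrow> real \<Rightarrow> real"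
  assumes "finite S" and "card S \<ge> 2"
    and "D = real_interval x\<^sub>a x\<^sub>b"
    and "\<And>i. i \<in> S \<Longrightarrow> strictly_convex_on D (f i)"
    and "\<And>T. T \<subseteq> S \<Longrightarrow> T \<noteq> {} \<Longrightarrow> \<exists>x. is_arg_min (worst_cost f T) (\<lambda>x. x \<in> D) x"
  shows "(\<exists>k\<in>S. \<exists>l\<in>S. k \<noteq> l \<and>
            (\<forall>i\<in>S. f i (minimax_solution f D {k, l})
                   \<le> worst_cost f {k, l} (minimax_solution f D {k, l}))) \<and>
         (\<forall>k\<in>S. \<forall>l\<in>S. k \<noteq> l \<longrightarrow>
            (\<forall>i\<in>S. f i (minimax_solution f D {k, l})
                   \<le> worst_cost f {k, l} (minimax_solution f D {k, l})) \<longrightarrow>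
            minimax_solution f D S = minimax_solution f D {k, l} \<and>
            (\<forall>T. T \<subseteq> S \<and> k \<in> T \<and> l \<in> T \<longrightarrow>
                 minimax_solution f D T = minimax_solution f D {k, l}))"
proof -
  define sol where "sol T = minimax_solution f D T" for T
  define val where "val T = worst_cost f T (sol T)" for T
  have sol_min: "is_arg_min (worst_cost f T) (\<lambda>x. x \<in> D) (sol T)" if "T \<subseteq> S" "T \<noteq> {}" for T
    unfolding sol_def using that assms(1,4,5) finite_subset
    by (intro is_arg_min_minimax_solution) blast+
  have sol_in: "sol T \<in> D" if "T \<subseteq> S" "T \<noteq> {}" for T
    using sol_min[OF that] by (simp add: is_arg_min_def)

  have "\<exists>k\<in>S. \<exists>l\<in>S. k \<noteq> l \<and> (\<forall>i\<in>S. f i (sol {k, l}) \<le> worst_cost f {k, l} (sol {k, l}))"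
  proof -
    define P where "P = {T. T \<subseteq> S \<and> card T = 2}"
    have "finite P"
      unfolding P_def using assms(1) by simp
    moreover have "P \<noteq> {}"
      using obtain_subset_with_card_n[OF assms(2)] by (auto simp: P_def)
    ultimately have "Max (val ` P) \<in> val ` P"
      by simp
    then obtain U where U: "U \<in> P" "Max (val ` P) = val U"
      by blast
    then have U_max: "val T \<le> val U" if "T \<in> P" for T
      using that Max_ge[of "val ` P" "val T"] \<open>finite P\<close> by simp
    obtain k l where kl: "U = {k, l}" "k \<noteq> l"
      using U(1) by (auto simp: P_def card_2_iff)
    have kl_S: "k \<in> S" "l \<in> S"
      using U(1) by (auto simp: P_def kl)
    have "f i (sol {k, l}) \<le> worst_cost f {k, l} (sol {k, l})" if "i \<in> S" for i
    proof (cases "i \<in> {k, l}")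
      case True
      then show ?thesis
        using worst_cost_le_iff[of "{k, l}" f] by blast
    next
      case False
      then have "{k, i} \<in> P" "{l, i} \<in> P"
        using kl_S that by (auto simp: P_def)
      then have "val {k, i} \<le> val {k, l}" "val {l, i} \<le> val {k, l}"
        using U_max by (auto simp: kl)
      then show ?thesis
        using third_scenario_dominated[of i k l D f "sol {k, l}" "sol {k, i}" "sol {l, i}"]
          assms(4) sol_min[of "{k, l}"] sol_in[of "{k, i}"] sol_in[of "{l, i}"] kl_S that
        by (auto simp: val_def)
    qed
    then show ?thesis
      using kl_S kl(2) by blast
  qed
  moreover have "sol T = sol {k, l}"
    if "T \<subseteq> S" "k \<in> T" "l \<in> T"
      and dominated: "\<forall>i\<in>S. f i (sol {k, l}) \<le> worst_cost f {k, l} (sol {k, l})" for T k l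
    unfolding sol_def
  proof (rule minimax_solution_superset)
    show "finite T"
      using that(1) assms(1) by (rule finite_subset)
    show "{k, l} \<subseteq> T"
      using that(2,3) by simp
    show "\<exists>x. is_arg_min (worst_cost f {k, l}) (\<lambda>x. x \<in> D) x"
      using sol_min[of "{k, l}"] that(1-3) by blast
    show "strictly_convex_on D (f i)" if "i \<in> T" for i
      using assms(4) that \<open>T \<subseteq> S\<close> by blast
    show "f i (minimax_solution f D {k, l}) \<le> worst_cost f {k, l} (minimax_solution f D {k, l})"
      if "i \<in> T" for i
      using dominated that \<open>T \<subseteq> S\<close> unfolding sol_def by blast
  qed simp
  ultimately show ?thesis
    unfolding sol_def by blast
qed

end
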